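(* Let $n\geq 2$, let $\delta_n$ be the chromatic number of the $n$-dimensional simple permutoassociahedron $PA_n$ and let $\alpha_{n-1}$ be the chromatic number of the $(n-1)$-dimensional associahedron (with respect to proper colourings of facets). Then $$\delta_n=\alpha_{n-1}+1.$$
   Context: For $n\geq 1$ let $[n]=\{1,\ldots,n\}$ and $[n]_0=\{0,1,\ldots,n\}$. For a family of sets $N$, an $N$-antichain is a subset $\{X_1,\ldots,X_m\}\subseteq N$ with $m\geq 2$ whose members are mutually incomparable with respect to $\subseteq$. A simple polytope $P$ realises a simplicial complex $K$ when the face lattice of $P$ with the bottom (the empty face) removed is isomorphic to $(K,\supseteq)$; then facets of $P$ correspond to the vertices of $K$, and two facets have a common vertex iff some simplex of $K$ contains both corresponding vertices. Associahedron. Let $\mathcal{B}$ be the collection of all sets $[a,b]=\{x\mid a\leq x\leq b\}$, $0\leq a\leq b\leq n$ (nonempty connected vertex sets of the path $0-1-\cdots-n$). A set $N\subseteq\mathcal{B}$ is nested when the union of every $N$-antichain is not an element of $\mathcal{B}$. The $n$-dimensional associahedron is the simple $n$-dimensional polytope realising the simplicial complex of all nested sets $N$ with $[n]_0\notin N$. Simple permutoassociahedron. Let $C_1$ be the simplicial complex whose simplices are the sets $\{X_1,\ldots,X_l\}$ with $[n]_0\supset X_1\supset\cdots\supset X_l\supset\emptyset$ (strict inclusions), i.e. chains of nonempty proper subsets of $[n]_0$. Let $\mathcal{B}_1\subseteq C_1$ be the family of all sets of the form $$\bigl\{\{i_{k+l},\ldots,i_k,\ldots,i_1\},\ldots,\{i_{k+l},\ldots,i_k,i_{k-1}\},\{i_{k+l},\ldots,i_k\}\bigr\},$$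 where $1\leq k\leq k+l\leq n$ and $i_1,\ldots,i_{k+l}$ are mutually distinct elements of $[n]_0$ (so each element of $\mathcal{B}_1$ is a chain of $k$ sets of consecutive cardinalities $l+1,\ldots,l+k$). A set $N\subseteq\mathcal{B}_1$ is a 1-nested set when the union of every $N$-antichain is an element of $C_1-\mathcal{B}_1$. The simplicial complex $C$ of all 1-nested sets is realised by a simple $n$-dimensional polytope, called the simple permutoassociahedron $PA_n$; its facets correspond to the elements of $\mathcal{B}_1$. Two facets of a polytope are separated when they have no vertex in common. For $\mathcal{F}$ the set of facets of a polytope, a function $f\colon\mathcal{F}\to[m]$ is a proper colouring when every two (distinct) facets of the same colour are separated. The chromatic number of the polytope is the minimal $m$ such that a proper colouring of its facets with $m$ colours exists. *)

theory Defs
  imports "HOL-Analysis.Analysis"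
begin

definition antichain_in :: "'a set set \<Rightarrow> 'a set set \<Rightarrow> bool" where
  "antichain_in N A \<longleftrightarrow>
     A \<subseteq> N \<and> finite A \<and> 2 \<le> card A \<and>
     (\<forall>X\<in>A. \<forall>Y\<in>A. X \<noteq> Y \<longrightarrow> \<not> X \<subseteq> Y \<and> \<not> Y \<subseteq> X)"


section \<open>Polytopes\<close>

text \<open>The argument is allowed to be a polytope of lower dimension than the ambient space;
  its dimension is the affine dimension.\<close>

definition simple_polytope :: "'a::euclidean_space set \<Rightarrow> bool" where
  "simple_polytope P \<longleftrightarrow>
     polytope P \<and>
     (\<forall>v. v extreme_point_of P \<longrightarrow> int (card {F. F facet_of P \<and> v \<in> F}) = aff_dim P)"

text \<open>The empty simplex belongs to \<open>K\<close> and corresponds to the improper face \<open>P\<close>.\<close>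

definition realises :: "'a::euclidean_space set \<Rightarrow> 'v set set \<Rightarrow> bool" where
  "realises P K \<longleftrightarrow>
     (\<exists>\<phi>. bij_betw \<phi> {F. F face_of P \<and> F \<noteq> {}} K \<and>
          (\<forall>F G. F face_of P \<and> F \<noteq> {} \<and> G face_of P \<and> G \<noteq> {} \<longrightarrow>
             (F \<subseteq> G \<longleftrightarrow> \<phi> G \<subseteq> \<phi> F)))"

definition separated_facets :: "'a::euclidean_space set \<Rightarrow> 'a set \<Rightarrow> 'a set \<Rightarrow> bool" where
  "separated_facets P F G \<longleftrightarrow> \<not> (\<exists>v. v extreme_point_of P \<and> v \<in> F \<and> v \<in> G)"

definition proper_facet_colouring ::
    "'a::euclidean_space set \<Rightarrow> nat \<Rightarrow> ('a set \<Rightarrow> nat) \<Rightarrow> bool" where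
  "proper_facet_colouring P m f \<longleftrightarrow>
     f \<in> {F. F facet_of P} \<rightarrow> {1..m} \<and>
     (\<forall>F G. F facet_of P \<and> G facet_of P \<and> F \<noteq> G \<and> f F = f G \<longrightarrow> separated_facets P F G)"

definition chromatic_number :: "'a::euclidean_space set \<Rightarrow> nat" where
  "chromatic_number P = (LEAST m. \<exists>f. proper_facet_colouring P m f)"


section \<open>The associahedron\<close>

definition path_intervals :: "nat \<Rightarrow> nat set set" where
  "path_intervals n = {{a..b} | a b. a \<le> b \<and> b \<le> n}"

definition nested :: "nat \<Rightarrow> nat set set \<Rightarrow> bool" where
  "nested n N \<longleftrightarrow>
     N \<subseteq> path_intervals n \<and> (\<forall>A. antichain_in N A \<longrightarrow> \<Union>A \<notin> path_intervals n)"

definition associahedron_complex :: "nat \<Rightarrow> nat set set set" where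
  "associahedron_complex n = {N. nested n N \<and> {0..n} \<notin> N}"

definition associahedron :: "nat \<Rightarrow> 'a::euclidean_space set \<Rightarrow> bool" where
  "associahedron n P \<longleftrightarrow>
     simple_polytope P \<and> aff_dim P = int n \<and> realises P (associahedron_complex n)"


section \<open>The simple permutoassociahedron\<close>

definition chain_complex :: "nat \<Rightarrow> nat set set set" where
  "chain_complex n = {C. (\<forall>X\<in>C. {} \<subset> X \<and> X \<subset> {0..n}) \<and> chain\<^sub>\<subseteq> C}"

text \<open>The member with index \<open>j\<close> of the chain given by \<open>i\<close>, \<open>k\<close>, \<open>l\<close> is
  \<open>{i (k + l), \<dots>, i (j + 1), i j}\<close>, for \<open>j = 1, \<dots>, k\<close>.\<close>

definition consecutive_chains :: "nat \<Rightarrow> nat set set set" where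
  "consecutive_chains n =
     {(\<lambda>j. i ` {j..k + l}) ` {1..k} | (i :: nat \<Rightarrow> nat) k l.
        1 \<le> k \<and> k + l \<le> n \<and> inj_on i {1..k + l} \<and> i ` {1..k + l} \<subseteq> {0..n}}"

definition one_nested :: "nat \<Rightarrow> nat set set set \<Rightarrow> bool" where
  "one_nested n N \<longleftrightarrow>
     N \<subseteq> consecutive_chains n \<and>
     (\<forall>A. antichain_in N A \<longrightarrow> \<Union>A \<in> chain_complex n - consecutive_chains n)"

definition permutoassociahedron_complex :: "nat \<Rightarrow> nat set set set set" where
  "permutoassociahedron_complex n = {N. one_nested n N}"

definition simple_permutoassociahedron :: "nat \<Rightarrow> 'a::euclidean_space set \<Rightarrow> bool" where
  "simple_permutoassociahedron n P \<longleftrightarrow>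
     simple_polytope P \<and> aff_dim P = int n \<and> realises P (permutoassociahedron_complex n)"

end

theory Submission
  imports Defs
begin

text \<open>Facets of a polytope that realises a complex \<open>K\<close> are vertices of \<open>K\<close>, and two of them share a vertex of
  the polytope exactly when they span an edge of \<open>K\<close>. Both chromatic numbers are therefore those of
  the 1-skeleta of the two complexes (\<open>facet_colouring_iff_vertex_colouring\<close>).

  A set of cardinality \<open>c + 1\<close> in a chain of nonempty proper subsets of \<open>{0..n}\<close> is given the rank
  \<open>c\<close>, which lies in \<open>{0..n - 1}\<close>. A chain is recovered from any chain that contains it and from its
  ranks, and it is consecutive exactly when its ranks form an interval (\<open>consecutive_chains_iff\<close>).
  So \<open>ranks\<close> turns the defining condition of 1-nested pairs into the one of nested pairs of
  intervals in the path \<open>{0..n - 1}\<close>: it is a graph map, which sends distinct adjacent chains to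
  distinct adjacent intervals. The chains of initial segments \<open>{0..c}\<close> give a graph map in the
  opposite direction. Colourings pull back along both maps, so the simple permutoassociahedron
  needs exactly as many colours as the graph of all nested pairs of intervals
  (\<open>permutoassociahedron_colouring_iff\<close>).

  In that graph the whole path is comparable with, hence adjacent to, every other interval, and
  deleting it leaves the graph of the \<open>(n - 1)\<close>-dimensional associahedron. A cone needs exactly one
  colour more than its base (\<open>cone_colouring_iff\<close>), which is the extra colour.\<close>

section \<open>Vertex colourings of complexes\<close>

definition proper_vertex_colouring :: "'v set set \<Rightarrow> nat \<Rightarrow> ('v \<Rightarrow> nat) \<Rightarrow> bool" where
  "proper_vertex_colouring K m c \<longleftrightarrow>
     (\<forall>v. {v} \<in> K \<longrightarrow> c v \<in> {1..m}) \<and> (\<forall>v w. v \<noteq> w \<and> {v, w} \<in> K \<longrightarrow> c v \<noteq> c w)"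

definition subset_closed :: "'v set set \<Rightarrow> bool" where
  "subset_closed K \<longleftrightarrow> (\<forall>N\<in>K. \<forall>M. M \<subseteq> N \<longrightarrow> M \<in> K)"

lemma subset_closedD: "subset_closed K \<Longrightarrow> N \<in> K \<Longrightarrow> M \<subseteq> N \<Longrightarrow> M \<in> K"
  by (auto simp: subset_closed_def)

section \<open>From facets to vertices of the complex\<close>

lemma maximal_proper_face_is_facet:
  assumes "polytope P" "F face_of P" "F \<noteq> {}" "F \<noteq> P"
    and max: "\<And>G. G face_of P \<Longrightarrow> G \<noteq> P \<Longrightarrow> F \<subseteq> G \<Longrightarrow> G = F"
  shows "F facet_of P"
proof -
  obtain G where G: "G facet_of P" "F \<subseteq> G"
    using face_of_polyhedron_subset_facet[OF polytope_imp_polyhedron] assms by blast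
  then have "G face_of P" "G \<noteq> P"
    using facet_of_imp_face_of facet_of_irrefl by blast+
  then show ?thesis using max G by blast
qed

lemma facet_is_maximal_proper_face:
  assumes "convex P" "F facet_of P" "G face_of P" "G \<noteq> P" "F \<subseteq> G"
  shows "G = F"
proof (rule ccontr)
  assume "G \<noteq> F"
  have "F face_of G"
    using assms face_of_subset facet_of_imp_face_of face_of_imp_subset by metis
  then have "aff_dim F < aff_dim G"
    using \<open>G \<noteq> F\<close> assms face_of_aff_dim_lt face_of_imp_convex by metis
  moreover have "aff_dim G < aff_dim P"
    using assms face_of_aff_dim_lt by blast
  moreover have "aff_dim F = aff_dim P - 1"
    using assms by (simp add: facet_of_def)
  ultimately show False by linarith
qed

text \<open>The isomorphism reverses inclusion, so \<open>P\<close>, the largest face, belongs to the empty simplex, and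
  facets, the maximal proper faces, belong to the minimal nonempty simplices, which are singletons
  because \<open>K\<close> is closed under subsets. If \<open>{v, w}\<close> is a simplex, then its face is nonempty and
  has an extreme point, which lies in both facets; conversely the simplex of a common extreme point
  contains \<open>v\<close> and \<open>w\<close>.\<close>

lemma realises_facet_bijection:
  fixes P :: "'a::euclidean_space set" and K :: "'v set set"
  assumes P: "polytope P" "P \<noteq> {}" and "realises P K" and K: "subset_closed K"
  obtains g where "bij_betw g {v. {v} \<in> K} {F. F facet_of P}"
    and "\<And>v w. {v} \<in> K \<Longrightarrow> {w} \<in> K \<Longrightarrow> separated_facets P (g v) (g w) \<longleftrightarrow> {v, w} \<notin> K"
proof -
  let ?faces = "{F. F face_of P \<and> F \<noteq> {}}"
  obtain \<phi> where bij: "bij_betw \<phi> ?faces K"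
    and ord: "\<And>F G. F \<in> ?faces \<Longrightarrow> G \<in> ?faces \<Longrightarrow> F \<subseteq> G \<longleftrightarrow> \<phi> G \<subseteq> \<phi> F"
    using \<open>realises P K\<close> unfolding realises_def by force
  define \<psi> where "\<psi> = the_inv_into ?faces \<phi>"
  have cvx: "convex P" using P polytope_imp_convex by blast
  have in_K: "\<phi> F \<in> K" if "F \<in> ?faces" for F
    using that bij bij_betwE by blast
  have \<psi>: "\<psi> N \<in> ?faces" "\<phi> (\<psi> N) = N" if "N \<in> K" for N
    using that bij the_inv_into_into[of \<phi> ?faces N ?faces] f_the_inv_into_f_bij_betw[OF bij]
    unfolding \<psi>_def bij_betw_def by (blast, blast)
  have \<psi>\<phi>: "\<psi> (\<phi> F) = F" if "F \<in> ?faces" for F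
    using that bij unfolding \<psi>_def bij_betw_def by (metis the_inv_into_f_f)
  have \<psi>ord: "\<psi> N \<subseteq> \<psi> M \<longleftrightarrow> M \<subseteq> N" if "N \<in> K" "M \<in> K" for N M
    using ord[OF \<psi>(1) \<psi>(1)] \<psi>(2) that by simp
  have P_face: "P \<in> ?faces" using P cvx face_of_refl by blast
  have empty: "{} \<in> K"
    using K in_K[OF P_face] subset_closedD by blast
  have \<psi>_empty: "\<psi> {} = P"
  proof -
    have "\<psi> (\<phi> P) \<subseteq> \<psi> {}" using \<psi>ord[OF in_K[OF P_face] empty] by simp
    then have "P \<subseteq> \<psi> {}" using \<psi>\<phi>[OF P_face] by simp
    then show ?thesis using \<psi>(1)[OF empty] face_of_imp_subset by blast
  qed
  have facet: "\<psi> {v} facet_of P" if "{v} \<in> K" for v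
  proof (rule maximal_proper_face_is_facet)
    show "\<psi> {v} \<noteq> P"
      using \<psi>_empty \<psi>(2)[OF that] \<psi>(2)[OF empty] by auto
    fix G assume G: "G face_of P" "G \<noteq> P" "\<psi> {v} \<subseteq> G"
    have Gf: "G \<in> ?faces" using G \<psi>(1)[OF that] by auto
    have "\<phi> G \<subseteq> {v}" using \<psi>ord[OF that in_K[OF Gf]] \<psi>\<phi>[OF Gf] G by simp
    moreover have "\<phi> G \<noteq> {}" using G \<psi>_empty \<psi>\<phi>[OF Gf] by auto
    ultimately have "\<phi> G = {v}" by blast
    then show "G = \<psi> {v}" using \<psi>\<phi>[OF Gf] by simp
  qed (use P \<psi>[OF that] in auto)
  have onto: "\<exists>v. {v} \<in> K \<and> \<psi> {v} = F" if F: "F facet_of P" for F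
  proof -
    have Ff: "F \<in> ?faces" using F facet_of_imp_face_of by (auto simp: facet_of_def)
    have "\<phi> F \<noteq> {}"
      using \<psi>_empty \<psi>\<phi>[OF Ff] F facet_of_irrefl by metis
    then obtain v where v: "v \<in> \<phi> F" by blast
    have vK: "{v} \<in> K" using v K in_K[OF Ff] subset_closedD by blast
    have "F \<subseteq> \<psi> {v}" using \<psi>ord[OF in_K[OF Ff] vK] \<psi>\<phi>[OF Ff] v by simp
    then have "\<psi> {v} = F"
      using facet_is_maximal_proper_face[OF cvx F] facet[OF vK] facet_of_imp_face_of facet_of_irrefl
      by metis
    then show ?thesis using vK by blast
  qed
  have "bij_betw (\<lambda>v. \<psi> {v}) {v. {v} \<in> K} {F. F facet_of P}"
  proof (rule bij_betw_imageI)
    show "inj_on (\<lambda>v. \<psi> {v}) {v. {v} \<in> K}"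
      by (rule inj_onI) (metis \<psi>(2) mem_Collect_eq singleton_inject)
    show "(\<lambda>v. \<psi> {v}) ` {v. {v} \<in> K} = {F. F facet_of P}"
      using facet onto by force
  qed
  moreover have "separated_facets P (\<psi> {v}) (\<psi> {w}) \<longleftrightarrow> {v, w} \<notin> K"
    if vw: "{v} \<in> K" "{w} \<in> K" for v w
  proof
    assume sep: "separated_facets P (\<psi> {v}) (\<psi> {w})"
    show "{v, w} \<notin> K"
    proof
      assume e: "{v, w} \<in> K"
      let ?F = "\<psi> {v, w}"
      have F: "?F face_of P" "?F \<noteq> {}" using \<psi>(1)[OF e] by auto
      then have "compact ?F" "convex ?F"
        using P face_of_polytope_polytope polytope_imp_compact polytope_imp_convex by blast+
      then obtain p where "p extreme_point_of ?F"
        using extreme_point_exists_convex F by blast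
      then have "p extreme_point_of P" "p \<in> ?F"
        using extreme_point_of_face[OF F(1)] by auto
      moreover have "?F \<subseteq> \<psi> {v}" "?F \<subseteq> \<psi> {w}" using \<psi>ord e vw by auto
      ultimately show False using sep by (auto simp: separated_facets_def)
    qed
  next
    assume e: "{v, w} \<notin> K"
    show "separated_facets P (\<psi> {v}) (\<psi> {w})"
      unfolding separated_facets_def
    proof
      assume "\<exists>p. p extreme_point_of P \<and> p \<in> \<psi> {v} \<and> p \<in> \<psi> {w}"
      then obtain p where p: "p extreme_point_of P" "p \<in> \<psi> {v}" "p \<in> \<psi> {w}" by blast
      then have pf: "{p} \<in> ?faces" by (simp add: face_of_singleton)
      have "\<psi> (\<phi> {p}) \<subseteq> \<psi> {v}" "\<psi> (\<phi> {p}) \<subseteq> \<psi> {w}" using p \<psi>\<phi>[OF pf] by auto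
      then have "{v, w} \<subseteq> \<phi> {p}" using \<psi>ord[OF in_K[OF pf]] vw by auto
      then show False using e K in_K[OF pf] subset_closedD by blast
    qed
  qed
  ultimately show thesis by (rule that)
qed

lemma facet_colouring_iff_vertex_colouring:
  fixes P :: "'a::euclidean_space set" and K :: "'v set set"
  assumes "polytope P" "P \<noteq> {}" "realises P K" "subset_closed K"
  shows "(\<exists>f. proper_facet_colouring P m f) \<longleftrightarrow> (\<exists>c. proper_vertex_colouring K m c)"
proof -
  obtain g where bij: "bij_betw g {v. {v} \<in> K} {F. F facet_of P}"
    and sep: "\<And>v w. {v} \<in> K \<Longrightarrow> {w} \<in> K \<Longrightarrow> separated_facets P (g v) (g w) \<longleftrightarrow> {v, w} \<notin> K"
    using realises_facet_bijection[OF assms] by blast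
  let ?h = "the_inv_into {v. {v} \<in> K} g"
  have ends: "{v} \<in> K" "{w} \<in> K" if "{v, w} \<in> K" for v w
    using that assms(4) subset_closedD[of K "{v, w}"] by auto
  have g: "g v facet_of P" if "{v} \<in> K" for v
    using that bij by (auto simp: bij_betw_def)
  have g_inj: "v = w" if "g v = g w" "{v} \<in> K" "{w} \<in> K" for v w
    using that bij by (auto simp: bij_betw_def inj_on_def)
  have h: "{?h F} \<in> K" "g (?h F) = F" if "F facet_of P" for F
  proof -
    have "?h F \<in> {v. {v} \<in> K}"
      using bij that by (intro the_inv_into_into) (auto simp: bij_betw_def)
    then show "{?h F} \<in> K" by simp
    show "g (?h F) = F"
      using bij that by (intro f_the_inv_into_f_bij_betw) auto
  qed
  show ?thesis
  proof
    assume "\<exists>f. proper_facet_colouring P m f"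
    then obtain f where f: "proper_facet_colouring P m f" by blast
    have "proper_vertex_colouring K m (f \<circ> g)"
      unfolding proper_vertex_colouring_def
    proof (intro conjI allI impI)
      fix v assume "{v} \<in> K"
      then show "(f \<circ> g) v \<in> {1..m}"
        using f g[of v] unfolding proper_facet_colouring_def by auto
    next
      fix v w assume "v \<noteq> w \<and> {v, w} \<in> K"
      then show "(f \<circ> g) v \<noteq> (f \<circ> g) w"
        using f g ends[of v w] sep[of v w] g_inj[of v w] unfolding proper_facet_colouring_def comp_def
        by blast
    qed
    then show "\<exists>c. proper_vertex_colouring K m c" by blast
  next
    assume "\<exists>c. proper_vertex_colouring K m c"
    then obtain c where c: "proper_vertex_colouring K m c" by blast
    have "proper_facet_colouring P m (c \<circ> ?h)"
      unfolding proper_facet_colouring_def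
    proof (intro conjI allI impI)
      show "c \<circ> ?h \<in> {F. F facet_of P} \<rightarrow> {1..m}"
        using c h(1) unfolding proper_vertex_colouring_def by auto
    next
      fix F G assume FG: "F facet_of P \<and> G facet_of P \<and> F \<noteq> G \<and> (c \<circ> ?h) F = (c \<circ> ?h) G"
      then have "{?h F, ?h G} \<notin> K"
        using c h[of F] h[of G] unfolding proper_vertex_colouring_def comp_def by metis
      then show "separated_facets P F G"
        using sep[of "?h F" "?h G"] h[of F] h[of G] FG by simp
    qed
    then show "\<exists>f. proper_facet_colouring P m f" by blast
  qed
qed

section \<open>Colourings along maps and over cones\<close>

text \<open>The endpoints of an edge must have distinct images, since \<open>{h v, h w} \<in> L\<close> alone would allow
  an edge to collapse to a vertex.\<close>

lemma vertex_colouring_pullback: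
  assumes c: "proper_vertex_colouring L m c"
    and vertex: "\<And>v. {v} \<in> K \<Longrightarrow> {h v} \<in> L"
    and edge: "\<And>v w. v \<noteq> w \<Longrightarrow> {v, w} \<in> K \<Longrightarrow> h v \<noteq> h w \<and> {h v, h w} \<in> L"
  shows "proper_vertex_colouring K m (c \<circ> h)"
  using assms unfolding proper_vertex_colouring_def by simp

text \<open>The apex is adjacent to every other vertex, so its colour occurs nowhere else and is lost when
  the apex is deleted.\<close>

lemma cone_colouring_iff:
  assumes apex: "{t} \<in> K" and cone: "\<And>v. {v} \<in> K \<Longrightarrow> {v, t} \<in> K" and K: "subset_closed K"
  shows "(\<exists>c. proper_vertex_colouring K (Suc m) c) \<longleftrightarrow>
         (\<exists>c. proper_vertex_colouring {N \<in> K. t \<notin> N} m c)"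
proof
  assume "\<exists>c. proper_vertex_colouring K (Suc m) c"
  then obtain c where c: "proper_vertex_colouring K (Suc m) c" by blast
  have range: "c v \<in> {1..Suc m}" if "{v} \<in> K" for v
    using c that unfolding proper_vertex_colouring_def by blast
  have proper: "c v \<noteq> c w" if "v \<noteq> w" "{v, w} \<in> K" for v w
    using c that unfolding proper_vertex_colouring_def by blast
  have c_t: "c v \<noteq> c t" if "{v} \<in> K" "v \<noteq> t" for v
    using proper cone that by blast
  \<comment> \<open>The colour of the apex is free in the base, but need not be the last one: the vertices coloured
    \<open>Suc m\<close> take it over.\<close>
  have "proper_vertex_colouring {N \<in> K. t \<notin> N} m (\<lambda>v. if c v = Suc m then c t else c v)"
    unfolding proper_vertex_colouring_def
  proof (intro conjI allI impI)
    fix v assume v: "{v} \<in> {N \<in> K. t \<notin> N}"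
    then show "(if c v = Suc m then c t else c v) \<in> {1..m}"
      using range[of v] range[OF apex] c_t[of v] by auto
  next
    fix v w assume vw: "v \<noteq> w \<and> {v, w} \<in> {N \<in> K. t \<notin> N}"
    then have "{v} \<in> K" "{w} \<in> K" using K subset_closedD[of K "{v, w}"] by auto
    then show "(if c v = Suc m then c t else c v) \<noteq> (if c w = Suc m then c t else c w)"
      using vw proper[of v w] c_t[of v] c_t[of w] by auto
  qed
  then show "\<exists>c. proper_vertex_colouring {N \<in> K. t \<notin> N} m c" by blast
next
  assume "\<exists>c. proper_vertex_colouring {N \<in> K. t \<notin> N} m c"
  then obtain c where c: "proper_vertex_colouring {N \<in> K. t \<notin> N} m c" by blast
  have range: "c v \<in> {1..m}" if "{v} \<in> K" "v \<noteq> t" for v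
    using c that unfolding proper_vertex_colouring_def by auto
  have proper: "c v \<noteq> c w" if "v \<noteq> w" "{v, w} \<in> K" "v \<noteq> t" "w \<noteq> t" for v w
    using c that unfolding proper_vertex_colouring_def by auto
  have "proper_vertex_colouring K (Suc m) (c(t := Suc m))"
    unfolding proper_vertex_colouring_def
  proof (intro conjI allI impI)
    fix v assume "{v} \<in> K"
    then show "(c(t := Suc m)) v \<in> {1..Suc m}" using range[of v] by auto
  next
    fix v w assume vw: "v \<noteq> w \<and> {v, w} \<in> K"
    then have "{v} \<in> K" "{w} \<in> K" using K subset_closedD[of K "{v, w}"] by auto
    then show "(c(t := Suc m)) v \<noteq> (c(t := Suc m)) w"
      using vw proper[of v w] range[of v] range[of w] by auto
  qed
  then show "\<exists>c. proper_vertex_colouring K (Suc m) c" by blast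
qed

lemma finite_vertices_imp_colouring:
  assumes "finite {v. {v} \<in> K}" and K: "subset_closed K"
  shows "\<exists>m c. proper_vertex_colouring K m c"
proof -
  let ?V = "{v. {v} \<in> K}"
  obtain c where c: "bij_betw c ?V {0..<card ?V}"
    using ex_bij_betw_finite_nat[OF assms(1)] by blast
  have "proper_vertex_colouring K (card ?V) (Suc \<circ> c)"
    unfolding proper_vertex_colouring_def
  proof (intro conjI allI impI)
    fix v assume "{v} \<in> K"
    then have "c v < card ?V" using c unfolding bij_betw_def by auto
    then show "(Suc \<circ> c) v \<in> {1..card ?V}" by simp
  next
    fix v w assume vw: "v \<noteq> w \<and> {v, w} \<in> K"
    then have "{v} \<in> K" "{w} \<in> K" using K subset_closedD[of K "{v, w}"] by auto
    then show "(Suc \<circ> c) v \<noteq> (Suc \<circ> c) w"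
      using vw c unfolding bij_betw_def inj_on_def by auto
  qed
  then show ?thesis by blast
qed

section \<open>Ranks of consecutive chains\<close>

text \<open>Cardinalities are lowered by one because the sets of a chain have cardinalities \<open>1, \<dots>, n\<close>, while
  the path of the \<open>(n - 1)\<close>-dimensional associahedron has the vertices \<open>0, \<dots>, n - 1\<close>.\<close>

definition ranks :: "nat set set \<Rightarrow> nat set" where
  "ranks X = (\<lambda>S. card S - 1) ` X"

definition initial_segments :: "nat set \<Rightarrow> nat set set" where
  "initial_segments I = (\<lambda>c. {0..c}) ` I"

lemma chain_complexD:
  assumes "X \<in> chain_complex n" "S \<in> X"
  shows "finite S" "S \<subset> {0..n}" "card S = Suc (card S - 1)"
proof -
  have "S \<noteq> {}" using assms by (auto simp: chain_complex_def)
  show "S \<subset> {0..n}" using assms by (auto simp: chain_complex_def)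
  then show "finite S" using finite_subset by blast
  then have "0 < card S" using \<open>S \<noteq> {}\<close> by (simp add: card_gt_0_iff)
  then show "card S = Suc (card S - 1)" by simp
qed

lemma chain_complex_comparable:
  assumes "X \<in> chain_complex n" "S \<in> X" "T \<in> X"
  shows "S \<subseteq> T \<or> T \<subseteq> S"
  using assms unfolding chain_complex_def chain_subset_def by blast

lemma inj_on_rank:
  assumes X: "X \<in> chain_complex n"
  shows "inj_on (\<lambda>S. card S - 1) X"
proof (rule inj_onI)
  fix S T assume ST: "S \<in> X" "T \<in> X" "card S - 1 = card T - 1"
  then have "card S = card T" using chain_complexD(3)[OF X] by metis
  then show "S = T"
    using chain_complex_comparable[OF X ST(1,2)] card_subset_eq chain_complexD(1)[OF X] ST by metis
qed

lemma chain_complex_mono: "X \<in> chain_complex n \<Longrightarrow> Y \<subseteq> X \<Longrightarrow> Y \<in> chain_complex n"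
  unfolding chain_complex_def chain_subset_def mem_Collect_eq by (meson subsetD)

text \<open>Successive sets of the chain differ by one element, so the elements can be listed in an order \<open>g\<close>
  in which they appear; only the order inside the smallest set is arbitrary. The induction removes
  the largest set.\<close>

lemma chain_with_interval_ranks_enumeration:
  assumes "a \<le> b" "X \<in> chain_complex n" "ranks X = {a..b}"
  shows "\<exists>g. inj_on g {..b} \<and> g ` {..b} \<subseteq> {0..n} \<and> X = (\<lambda>c. g ` {..c}) ` {a..b}"
  using assms
proof (induction b arbitrary: X rule: dec_induct)
  case base
  then have "a \<in> ranks X" by simp
  then obtain S where S: "S \<in> X" "card S - 1 = a" unfolding ranks_def by blast
  have X: "X = {S}"
  proof (intro equalityI subsetI)
    fix T assume T: "T \<in> X"
    then have "card T - 1 \<in> ranks X" unfolding ranks_def by (rule imageI)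
    then have "card T - 1 = card S - 1" using S(2) base(2) by simp
    then show "T \<in> {S}" using inj_onD[OF inj_on_rank[OF base(1)]] T S(1) by blast
  qed (use S in simp)
  have fin: "finite S" "S \<subset> {0..n}" "card S = Suc a"
    using chain_complexD[OF base(1) S(1)] S(2) by simp_all
  then obtain g where "bij_betw g {0..<Suc a} S"
    using ex_bij_betw_nat_finite by metis
  moreover have "{0..<Suc a} = {..a}" by auto
  ultimately have "inj_on g {..a}" "g ` {..a} = S" by (auto simp: bij_betw_def)
  then show ?case using X fin by (intro exI[of _ g]) auto
next
  case (step b)
  have "Suc b \<in> ranks X" using step by simp
  then obtain T where T: "T \<in> X" "card T - 1 = Suc b" unfolding ranks_def by force
  have inj: "inj_on (\<lambda>S. card S - 1) X" using inj_on_rank step.prems(1) by blast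
  have "ranks (X - {T}) = ranks X - {Suc b}"
    using inj_on_image_set_diff[OF inj, of X "{T}"] T unfolding ranks_def by auto
  also have "\<dots> = {a..b}" using step by auto
  finally have "ranks (X - {T}) = {a..b}" .
  from step.IH[OF chain_complex_mono[OF step.prems(1) Diff_subset] this]
  obtain g where g: "inj_on g {..b}" "g ` {..b} \<subseteq> {0..n}"
      "X - {T} = (\<lambda>c. g ` {..c}) ` {a..b}"
    by (elim exE conjE)
  let ?S = "g ` {..b}"
  have "?S \<in> X - {T}"
    unfolding g(3) using step.hyps by (intro imageI) simp
  then have S: "?S \<in> X" "?S \<noteq> T" by blast+
  have cS: "card ?S = Suc b" using g(1) by (simp add: card_image)
  have cT: "card T = Suc (Suc b)" "finite T" "T \<subseteq> {0..n}"
    using T chain_complexD[OF step.prems(1) T(1)] by auto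
  have sub: "?S \<subseteq> T"
    using chain_complex_comparable[OF step.prems(1) S(1) T(1)] card_mono[of ?S T] cS cT by auto
  have "card (T - ?S) = 1" using sub cS cT by (simp add: card_Diff_subset)
  then obtain t where t: "T - ?S = {t}" by (auto simp: card_1_singleton_iff)
  define h where "h = g(Suc b := t)"
  have h: "h ` {..c} = g ` {..c}" if "c \<le> b" for c
    using that unfolding h_def by (auto simp: image_def)
  have hT: "h ` {..Suc b} = T"
  proof -
    have "h ` {..Suc b} = insert (h (Suc b)) (h ` {..b})" by (simp only: atMost_Suc image_insert)
    also have "\<dots> = ?S \<union> (T - ?S)" using h[of b] t by (simp add: h_def del: Un_Diff_cancel)
    also have "\<dots> = T" using sub by (simp add: Un_absorb1)
    finally show ?thesis .
  qed
  have "inj_on h {..Suc b}"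
    by (rule eq_card_imp_inj_on) (simp_all only: hT cT finite_atMost card_atMost)
  moreover have "X = (\<lambda>c. h ` {..c}) ` {a..Suc b}"
  proof -
    have "{a..Suc b} = insert (Suc b) {a..b}" using step.hyps by auto
    then have "(\<lambda>c. h ` {..c}) ` {a..Suc b} = insert T ((\<lambda>c. h ` {..c}) ` {a..b})"
      using hT by simp
    also have "(\<lambda>c. h ` {..c}) ` {a..b} = X - {T}"
      unfolding g(3) by (rule image_cong) (simp_all add: h)
    also have "insert T (X - {T}) = X" using T(1) by (rule insert_Diff)
    finally show ?thesis by (rule sym)
  qed
  moreover have "h ` {..Suc b} \<subseteq> {0..n}" using cT(3) hT by simp
  ultimately show ?case by (intro exI[of _ h] conjI)
qed

text \<open>The sequence \<open>i\<close> in the definition of a consecutive chain lists the elements from the largest set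
  inwards, so it is the enumeration \<open>g\<close> of the previous lemma read backwards.\<close>

lemma consecutive_chains_iff:
  assumes "n \<ge> 1"
  shows "X \<in> consecutive_chains n \<longleftrightarrow> X \<in> chain_complex n \<and> ranks X \<in> path_intervals (n - 1)"
proof
  assume "X \<in> consecutive_chains n"
  then obtain i :: "nat \<Rightarrow> nat" and k l
    where X: "X = (\<lambda>j. i ` {j..k + l}) ` {1..k}" and kl: "1 \<le> k" "k + l \<le> n"
      and i: "inj_on i {1..k + l}" "i ` {1..k + l} \<subseteq> {0..n}"
    unfolding consecutive_chains_def by blast
  have card: "card (i ` {j..k + l}) = k + l + 1 - j" if "j \<in> {1..k}" for j
    using that inj_on_subset[OF i(1), of "{j..k + l}"] by (subst card_image) auto
  have "{} \<subset> S \<and> S \<subset> {0..n}" if "S \<in> X" for S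
  proof -
    obtain j where j: "j \<in> {1..k}" "S = i ` {j..k + l}" using X \<open>S \<in> X\<close> by blast
    have "S \<noteq> {}" using j by auto
    moreover have "S \<subseteq> {0..n}" using j i(2) by fastforce
    moreover have "card S < card {0..n}" using card[OF j(1)] j kl by auto
    ultimately show ?thesis by auto
  qed
  moreover have "chain\<^sub>\<subseteq> X"
    unfolding chain_subset_def
  proof (intro ballI)
    fix S T assume "S \<in> X" "T \<in> X"
    then obtain j j' where "S = i ` {j..k + l}" "T = i ` {j'..k + l}" using X by blast
    then show "S \<subseteq> T \<or> T \<subseteq> S"
      by (cases "j \<le> j'") (auto intro!: image_mono)
  qed
  ultimately have "X \<in> chain_complex n" by (simp add: chain_complex_def)
  moreover have "ranks X = {l..k + l - 1}"
  proof -
    have "ranks X = (\<lambda>j. k + l - j) ` {1..k}"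
      unfolding ranks_def X image_image using card by (intro image_cong) auto
    also have "\<dots> = {l..k + l - 1}"
    proof (intro equalityI subsetI)
      fix c assume "c \<in> {l..k + l - 1}"
      then have "c = k + l - (k + l - c)" "k + l - c \<in> {1..k}" using kl by auto
      then show "c \<in> (\<lambda>j. k + l - j) ` {1..k}" by blast
    qed auto
    finally show ?thesis .
  qed
  moreover have "l \<le> k + l - 1" "k + l - 1 \<le> n - 1" using kl by auto
  ultimately show "X \<in> chain_complex n \<and> ranks X \<in> path_intervals (n - 1)"
    unfolding path_intervals_def by blast
next
  assume X: "X \<in> chain_complex n \<and> ranks X \<in> path_intervals (n - 1)"
  then obtain a b where ab: "a \<le> b" "b \<le> n - 1" "ranks X = {a..b}"
    unfolding path_intervals_def by blast
  then obtain g where g: "inj_on g {..b}" "g ` {..b} \<subseteq> {0..n}"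
      "X = (\<lambda>c. g ` {..c}) ` {a..b}"
    using chain_with_interval_ranks_enumeration X by metis
  define k where "k = Suc b - a"
  have k: "1 \<le> k" "k + a = Suc b" "k + a \<le> n" using ab assms by (auto simp: k_def)
  let ?i = "\<lambda>j. g (Suc b - j)"
  have reflect: "?i ` {j..Suc b} = g ` {..Suc b - j}" if "j \<le> Suc b" for j
  proof -
    have "(\<lambda>j. Suc b - j) ` {j..Suc b} = {..Suc b - j}"
    proof (intro equalityI subsetI)
      fix c assume "c \<in> {..Suc b - j}"
      then have "c = Suc b - (Suc b - c)" "Suc b - c \<in> {j..Suc b}" using that by auto
      then show "c \<in> (\<lambda>j. Suc b - j) ` {j..Suc b}" by blast
    qed auto
    then show ?thesis by (metis image_image)
  qed
  have "inj_on ?i {1..Suc b}"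
  proof (rule inj_onI)
    fix x y assume xy: "x \<in> {1..Suc b}" "y \<in> {1..Suc b}" "g (Suc b - x) = g (Suc b - y)"
    then have "Suc b - x = Suc b - y" using inj_onD[OF g(1) xy(3)] by auto
    then show "x = y" using xy by auto
  qed
  moreover have "?i ` {1..Suc b} \<subseteq> {0..n}" using reflect[of 1] g(2) by simp
  moreover have "X = (\<lambda>j. ?i ` {j..Suc b}) ` {1..k}"
  proof -
    have "(\<lambda>j. ?i ` {j..Suc b}) ` {1..k} = (\<lambda>j. g ` {..Suc b - j}) ` {1..k}"
    proof (rule image_cong[OF refl])
      fix j assume "j \<in> {1..k}"
      then show "?i ` {j..Suc b} = g ` {..Suc b - j}" using k by (intro reflect) auto
    qed
    also have "\<dots> = (\<lambda>c. g ` {..c}) ` ((\<lambda>j. Suc b - j) ` {1..k})" by (simp add: image_image)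
    also have "(\<lambda>j. Suc b - j) ` {1..k} = {a..b}"
    proof (intro equalityI subsetI)
      fix c assume "c \<in> {a..b}"
      then have "c = Suc b - (Suc b - c)" "Suc b - c \<in> {1..k}" by (auto simp: k_def)
      then show "c \<in> (\<lambda>j. Suc b - j) ` {1..k}" by blast
    qed (use k in auto)
    finally show ?thesis using g(3) by simp
  qed
  ultimately show "X \<in> consecutive_chains n"
    unfolding consecutive_chains_def using k
    by (intro CollectI exI[of _ ?i] exI[of _ k] exI[of _ a]) auto
qed

lemma ranks_initial_segments: "ranks (initial_segments I) = I"
  by (simp add: ranks_def initial_segments_def image_image)

lemma initial_segments_chain:
  assumes "n \<ge> 1" "I \<subseteq> {0..n - 1}"
  shows "initial_segments I \<in> chain_complex n"
proof -
  have "{} \<subset> {0..c} \<and> {0..c} \<subset> {0..n}" if "c \<in> I" for c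
  proof -
    have "c < n" using that assms by force
    then have "n \<in> {0..n} - {0..c}" "0 \<in> {0..c}" by auto
    then show ?thesis using \<open>c < n\<close> by (auto simp: psubset_eq)
  qed
  moreover have "{0..c} \<subseteq> {0..d} \<or> {0..d} \<subseteq> {0..c}" for c d :: nat
    by auto
  ultimately show ?thesis
    unfolding chain_complex_def chain_subset_def initial_segments_def by blast
qed

section \<open>The graphs of the two complexes\<close>

lemma antichain_in_subset: "antichain_in M A \<Longrightarrow> M \<subseteq> N \<Longrightarrow> antichain_in N A"
  unfolding antichain_in_def by (meson subset_trans)

lemma antichain_in_pair_iff:
  "antichain_in {X, Y} A \<longleftrightarrow> A = {X, Y} \<and> \<not> X \<subseteq> Y \<and> \<not> Y \<subseteq> X"
proof
  assume A: "antichain_in {X, Y} A"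
  then have sub: "A \<subseteq> {X, Y}" and "2 \<le> card A" by (auto simp: antichain_in_def)
  moreover have "card {X, Y} \<le> 2" by (simp add: card_insert_if)
  ultimately have "A = {X, Y}" by (intro card_seteq) auto
  moreover from this have "X \<noteq> Y" using \<open>2 \<le> card A\<close> by auto
  ultimately show "A = {X, Y} \<and> \<not> X \<subseteq> Y \<and> \<not> Y \<subseteq> X"
    using A by (auto simp: antichain_in_def)
next
  assume A: "A = {X, Y} \<and> \<not> X \<subseteq> Y \<and> \<not> Y \<subseteq> X"
  then have "X \<noteq> Y" by auto
  then show "antichain_in {X, Y} A" using A by (auto simp: antichain_in_def)
qed

lemma nested_pair_iff:
  "nested n {X, Y} \<longleftrightarrow> X \<in> path_intervals n \<and> Y \<in> path_intervals n \<and>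
     (X \<subseteq> Y \<or> Y \<subseteq> X \<or> X \<union> Y \<notin> path_intervals n)"
  by (simp add: nested_def antichain_in_pair_iff) argo

lemma one_nested_pair_iff:
  "one_nested n {X, Y} \<longleftrightarrow> X \<in> consecutive_chains n \<and> Y \<in> consecutive_chains n \<and>
     (X \<subseteq> Y \<or> Y \<subseteq> X \<or> X \<union> Y \<in> chain_complex n - consecutive_chains n)"
  by (simp add: one_nested_def antichain_in_pair_iff) argo

lemma nested_singleton_iff: "nested n {X} \<longleftrightarrow> X \<in> path_intervals n"
  using nested_pair_iff[of n X X] by simp

lemma subset_closed_nested: "subset_closed {N. nested n N}"
  unfolding subset_closed_def
proof (intro ballI allI impI CollectI)
  fix N M assume N: "N \<in> {N. nested n N}" and M: "M \<subseteq> N"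
  then have "\<Union>A \<notin> path_intervals n" if "antichain_in M A" for A
    using antichain_in_subset[OF that M] by (simp add: nested_def)
  then show "nested n M"
    using N subset_trans[OF M] by (simp add: nested_def)
qed

lemma subset_closed_associahedron: "subset_closed (associahedron_complex n)"
  unfolding subset_closed_def
proof (intro ballI allI impI)
  fix N M assume N: "N \<in> associahedron_complex n" and M: "M \<subseteq> N"
  then have "nested n M"
    using subset_closedD[OF subset_closed_nested, of N n M] by (simp add: associahedron_complex_def)
  then show "M \<in> associahedron_complex n"
    using N subsetD[OF M] by (auto simp: associahedron_complex_def)
qed

lemma subset_closed_permutoassociahedron: "subset_closed (permutoassociahedron_complex n)"
  unfolding subset_closed_def permutoassociahedron_complex_def
proof (intro ballI allI impI CollectI)
  fix N M assume N: "N \<in> {N. one_nested n N}" and M: "M \<subseteq> N"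
  then have "\<Union>A \<in> chain_complex n - consecutive_chains n" if "antichain_in M A" for A
    using antichain_in_subset[OF that M] by (simp add: one_nested_def)
  then show "one_nested n M"
    using N subset_trans[OF M] by (simp add: one_nested_def)
qed

lemma path_interval_subset: "I \<in> path_intervals n \<Longrightarrow> I \<subseteq> {0..n}"
  by (auto simp: path_intervals_def)

text \<open>Restricted to subchains of the maximal chain of initial segments, the condition that \<open>X \<union> Y\<close>
  is a chain always holds, and 1-nestedness is nestedness of the ranks.\<close>

lemma one_nested_initial_segments:
  assumes n: "n \<ge> 1" and IJ: "nested (n - 1) {I, J}"
  shows "one_nested n {initial_segments I, initial_segments J}"
proof -
  have un: "initial_segments I \<union> initial_segments J = initial_segments (I \<union> J)"
    by (auto simp: initial_segments_def)
  have chain: "initial_segments L \<in> chain_complex n" if "L \<subseteq> {0..n - 1}" for L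
    using initial_segments_chain[OF n that] .
  have consecutive: "initial_segments L \<in> consecutive_chains n \<longleftrightarrow> L \<in> path_intervals (n - 1)"
    if "L \<subseteq> {0..n - 1}" for L
    using chain[OF that] by (simp add: consecutive_chains_iff[OF n] ranks_initial_segments)
  have mono: "initial_segments L \<subseteq> initial_segments M" if "L \<subseteq> M" for L M
    unfolding initial_segments_def using that by (rule image_mono)
  have I: "I \<subseteq> {0..n - 1}" "I \<in> path_intervals (n - 1)"
    and J: "J \<subseteq> {0..n - 1}" "J \<in> path_intervals (n - 1)"
    using IJ path_interval_subset by (simp_all add: nested_pair_iff)
  have U: "I \<union> J \<subseteq> {0..n - 1}" using I(1) J(1) by (rule Un_least)
  have "I \<subseteq> J \<or> J \<subseteq> I \<or> I \<union> J \<notin> path_intervals (n - 1)"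
    using IJ by (simp only: nested_pair_iff)
  then have "initial_segments I \<subseteq> initial_segments J \<or> initial_segments J \<subseteq> initial_segments I \<or>
      initial_segments (I \<union> J) \<in> chain_complex n - consecutive_chains n"
    using mono chain[OF U] consecutive[OF U] by (metis DiffI)
  then show ?thesis
    using I J consecutive by (simp only: one_nested_pair_iff un)
qed

text \<open>Suppose that the ranks of \<open>X\<close> and \<open>Y\<close> are incomparable and form an interval together. Then \<open>X\<close>
  and \<open>Y\<close> are incomparable, so \<open>X \<union> Y\<close> is a chain, and it is consecutive because its ranks form an
  interval. This is what 1-nestedness excludes.\<close>

lemma nested_ranks:
  assumes n: "n \<ge> 1" and XY: "one_nested n {X, Y}"
  shows "nested (n - 1) {ranks X, ranks Y}"
proof -
  have "ranks X \<in> path_intervals (n - 1)" "ranks Y \<in> path_intervals (n - 1)"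
    using XY consecutive_chains_iff[OF n] unfolding one_nested_pair_iff by auto
  moreover have "ranks X \<subseteq> ranks Y \<or> ranks Y \<subseteq> ranks X \<or> ranks X \<union> ranks Y \<notin> path_intervals (n - 1)"
    using XY consecutive_chains_iff[OF n, of "X \<union> Y"] unfolding one_nested_pair_iff ranks_def image_Un
    by blast
  ultimately show ?thesis by (simp add: nested_pair_iff)
qed

text \<open>Adjacent \<open>X\<close> and \<open>Y\<close> lie in a common chain, and the sets of a chain are told apart by their
  cardinalities.\<close>

lemma one_nested_ranks_eq_imp_eq:
  assumes n: "n \<ge> 1" and XY: "one_nested n {X, Y}" and eq: "ranks X = ranks Y"
  shows "X = Y"
proof -
  have "X \<union> Y \<in> chain_complex n"
    using XY consecutive_chains_iff[OF n] unfolding one_nested_pair_iff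
    by (auto simp: Un_absorb1 Un_absorb2)
  then show ?thesis
    using inj_on_image_eq_iff[OF inj_on_rank, of "X \<union> Y" n X Y] eq unfolding ranks_def by auto
qed

lemma permutoassociahedron_colouring_iff:
  assumes n: "n \<ge> 1"
  shows "(\<exists>c. proper_vertex_colouring (permutoassociahedron_complex n) m c) \<longleftrightarrow>
         (\<exists>c. proper_vertex_colouring {N. nested (n - 1) N} m c)"
proof
  assume "\<exists>c. proper_vertex_colouring (permutoassociahedron_complex n) m c"
  then obtain c where c: "proper_vertex_colouring (permutoassociahedron_complex n) m c" by blast
  have "initial_segments I \<noteq> initial_segments J" if "I \<noteq> J" for I J
    using that ranks_initial_segments by metis
  then have "proper_vertex_colouring {N. nested (n - 1) N} m (c \<circ> initial_segments)"
    using one_nested_initial_segments[OF n] one_nested_initial_segments[OF n, of I I for I]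
    by (intro vertex_colouring_pullback[OF c]) (auto simp: permutoassociahedron_complex_def)
  then show "\<exists>c. proper_vertex_colouring {N. nested (n - 1) N} m c" by blast
next
  assume "\<exists>c. proper_vertex_colouring {N. nested (n - 1) N} m c"
  then obtain c where c: "proper_vertex_colouring {N. nested (n - 1) N} m c" by blast
  have "proper_vertex_colouring (permutoassociahedron_complex n) m (c \<circ> ranks)"
    using nested_ranks[OF n] nested_ranks[OF n, of X X for X] one_nested_ranks_eq_imp_eq[OF n]
    unfolding permutoassociahedron_complex_def mem_Collect_eq
    by (intro vertex_colouring_pullback[OF c]) (simp, metis mem_Collect_eq)
  then show "\<exists>c. proper_vertex_colouring (permutoassociahedron_complex n) m c" by blast
qed

lemma nested_colouring_Suc_iff:
  "(\<exists>c. proper_vertex_colouring {N. nested n N} (Suc m) c) \<longleftrightarrow>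
   (\<exists>c. proper_vertex_colouring (associahedron_complex n) m c)"
proof -
  have top: "{0..n} \<in> path_intervals n" unfolding path_intervals_def by blast
  then have "nested n {{0..n}}" "\<And>I. nested n {I} \<Longrightarrow> nested n {I, {0..n}}"
    using path_interval_subset unfolding nested_singleton_iff nested_pair_iff by blast+
  then show ?thesis
    using cone_colouring_iff[of "{0..n}" "{N. nested n N}" m] subset_closed_nested
    by (simp add: associahedron_complex_def)
qed

theorem theorem7p5:
  fixes n :: nat
    and PA :: "'a::euclidean_space set"
    and As :: "'b::euclidean_space set"
  assumes "n \<ge> 2"
    and "simple_permutoassociahedron n PA"
    and "associahedron (n - 1) As"
  shows "chromatic_number PA = chromatic_number As + 1"
proof -
  have n: "n \<ge> 1" using assms(1) by simp
  have PA: "polytope PA" "realises PA (permutoassociahedron_complex n)" "aff_dim PA = int n"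
    using assms(2) by (auto simp: simple_permutoassociahedron_def simple_polytope_def)
  have As: "polytope As" "realises As (associahedron_complex (n - 1))" "aff_dim As = int (n - 1)"
    using assms(3) by (auto simp: associahedron_def simple_polytope_def)
  have ne: "PA \<noteq> {}" "As \<noteq> {}" using PA(3) As(3) by auto
  have colPA: "(\<exists>f. proper_facet_colouring PA m f) \<longleftrightarrow>
      (\<exists>c. proper_vertex_colouring {N. nested (n - 1) N} m c)" for m
    using facet_colouring_iff_vertex_colouring[OF PA(1) ne(1) PA(2) subset_closed_permutoassociahedron]
      permutoassociahedron_colouring_iff[OF n] by simp
  have colAs: "(\<exists>f. proper_facet_colouring As m f) \<longleftrightarrow> (\<exists>f. proper_facet_colouring PA (Suc m) f)" for m
    using facet_colouring_iff_vertex_colouring[OF As(1) ne(2) As(2) subset_closed_associahedron]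
      nested_colouring_Suc_iff colPA by simp
  have "path_intervals (n - 1) \<subseteq> Pow {0..n - 1}"
    using path_interval_subset by blast
  then have "finite {I. {I} \<in> {N. nested (n - 1) N}}"
    by (simp add: nested_singleton_iff finite_subset)
  then obtain m where "\<exists>f. proper_facet_colouring PA m f"
    using finite_vertices_imp_colouring[OF _ subset_closed_nested] colPA by blast
  moreover have "\<not> (\<exists>f. proper_facet_colouring PA 0 f)"
  proof -
    have "{0..n - 1} \<in> path_intervals (n - 1)" unfolding path_intervals_def by blast
    then show ?thesis
      unfolding colPA proper_vertex_colouring_def by (auto simp: nested_singleton_iff)
  qed
  ultimately have "chromatic_number PA = Suc (LEAST m. \<exists>f. proper_facet_colouring PA (Suc m) f)"
    unfolding chromatic_number_def by (rule Least_Suc)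
  then show ?thesis by (simp add: chromatic_number_def colAs)
qed

end
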